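(* Let $n \geq 2$. There exist $C^1$ functions $f : \mathbf{R}^{n-1} \to \mathbf{R}$ whose graph $\Sigma = \{(y, f(y)) : y \in \mathbf{R}^{n-1}\} \subseteq \mathbf{R}^n$ (a $C^1$-hypersurface) has the following property: for every $r > 0$ and every open set $U \subseteq \mathbf{R}^n$ with $U \cap \delta_{\Sigma}^{-1}(r) \neq \varnothing$, the set $U \cap \delta_{\Sigma}^{-1}(r)$ fails to be a $C^1$-hypersurface.
   Context: For $S \subseteq \mathbf{R}^n$, the distance function is $\delta_S(x) = \inf\{|x-a| : a \in S\}$, $x \in \mathbf{R}^n$, and $\delta_S^{-1}(r) = \{x \in \mathbf{R}^n : \delta_S(x) = r\}$. A subset $M \subseteq \mathbf{R}^n$ is a $C^1$-hypersurface if for every $a \in M$ there exist an open subset $V$ of $\mathbf{R}^n$ with $a \in V$, an $(n-1)$-dimensional linear subspace $Z$ of $\mathbf{R}^n$, and a $C^1$-diffeomorphism $\sigma : V \to \sigma(V)$ onto an open subset of $\mathbf{R}^n$ such that $\sigma(V \cap M) = Z \cap \sigma(V)$. *)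

theory Defs
  imports "HOL-Analysis.Analysis"
begin

text \<open>The derivative is taken with respect to full neighbourhoods and is continuous for the
  operator norm, so this is the usual notion of a \<open>C\<^sup>1\<close> map when \<open>V\<close> is open
  (the only case in which it is used).\<close>

definition C1_on :: "('a::euclidean_space \<Rightarrow> 'b::euclidean_space) \<Rightarrow> 'a set \<Rightarrow> bool" where
  "C1_on f V \<longleftrightarrow>
     (\<exists>f' :: 'a \<Rightarrow> 'a \<Rightarrow>\<^sub>L 'b.
        (\<forall>x\<in>V. (f has_derivative blinfun_apply (f' x)) (at x)) \<and> continuous_on V f')"

definition C1_diffeo_on :: "('a::euclidean_space \<Rightarrow> 'a) \<Rightarrow> 'a set \<Rightarrow> bool" where
  "C1_diffeo_on \<sigma> V \<longleftrightarrow>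
     open V \<and> open (\<sigma> ` V) \<and> inj_on \<sigma> V \<and> C1_on \<sigma> V \<and> C1_on (inv_into V \<sigma>) (\<sigma> ` V)"

definition C1_hypersurface :: "'a::euclidean_space set \<Rightarrow> bool" where
  "C1_hypersurface M \<longleftrightarrow>
     (\<forall>a\<in>M. \<exists>V Z \<sigma>.
        open V \<and> a \<in> V \<and> subspace Z \<and> dim Z = DIM('a) - 1 \<and>
        C1_diffeo_on \<sigma> V \<and> \<sigma> ` (V \<inter> M) = Z \<inter> \<sigma> ` V)"

text \<open>For nonempty \<open>S\<close>, \<open>infdist x S\<close> is the infimum of the distances from \<open>x\<close> to the points
  of \<open>S\<close>; by library convention it is \<open>0\<close> for empty \<open>S\<close>.\<close>

definition dist_level :: "'a::euclidean_space set \<Rightarrow> real \<Rightarrow> 'a set" where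
  "dist_level S r = {x. infdist x S = r}"

text \<open>\<open>\<real>\<^sup>n\<close> is written as the product \<open>(real ^ 'm) \<times> real\<close> with \<open>CARD('m) = n - 1\<close>; the product norm
  is the Euclidean one, and \<open>n \<ge> 2\<close> because \<open>'m\<close> is nonempty.\<close>

definition graph_of :: "((real ^ 'm) \<Rightarrow> real) \<Rightarrow> ((real ^ 'm) \<times> real) set" where
  "graph_of f = {(y, f y) | y. y \<in> UNIV}"

end

theory Submission
  imports Defs
begin

text \<open>Take \<open>f y = g (y\<^sub>i)\<close>, where \<open>g' = h\<close> is a Weierstrass series. The part of a level set
  of the distance function on one side of the graph is, up to reflection, the graph of a
  sup-convolution \<open>max\<^sub>z g (t + z) + sqrt (r\<^sup>2 - z\<^sup>2)\<close>, whose maximisers give nearest points. Where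
  the level set is a hypersurface, all vectors from nearest points to \<open>a\<close> are normal to it at
  \<open>a\<close>, so the maximiser is unique. If this happened on an open subset of the level set, then, by
  connectedness, every point of some interval would be a maximiser for some \<open>t\<close>, i.e. a ball of
  radius \<open>r\<close> would touch the graph of \<open>g\<close> over it, always from the same side. This bounds
  the difference quotients of \<open>h\<close> on the interval from one side, but they are unbounded in both
  directions on every interval.\<close>

section \<open>Normals to a C^1 hypersurface\<close>

text \<open>If \<open>a\<close> minimises the distance to \<open>p\<close> over \<open>M\<close>,
  then \<open>a - p\<close> is orthogonal to the tangent space at \<open>a\<close>. That space has
  codimension one, so its orthogonal complement is a line, spanned by the nonzero
  \<open>a - p\<close> and containing \<open>a - q\<close>.\<close>

lemma C1_hypersurface_normals_parallel:
  fixes M :: "'a::euclidean_space set"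
  assumes M: "C1_hypersurface M" and a: "a \<in> M" and ne: "a \<noteq> p"
    and p: "\<And>x. x \<in> M \<Longrightarrow> dist a p \<le> dist x p"
    and q: "\<And>x. x \<in> M \<Longrightarrow> dist a q \<le> dist x q"
  obtains c where "a - q = c *\<^sub>R (a - p)"
proof -
  obtain V Z \<sigma> where V: "open V" "a \<in> V" and Z: "subspace Z" "dim Z = DIM('a) - 1"
    and \<sigma>: "C1_diffeo_on \<sigma> V" and im: "\<sigma> ` (V \<inter> M) = Z \<inter> \<sigma> ` V"
    using M a unfolding C1_hypersurface_def by metis
  define \<tau> where "\<tau> = inv_into V \<sigma>"
  have inj: "inj_on \<sigma> V" and op: "open (\<sigma> ` V)" using \<sigma> by (auto simp: C1_diffeo_on_def)
  obtain D where D: "(\<sigma> has_derivative blinfun_apply D) (at a)"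
    using \<sigma> V by (auto simp: C1_diffeo_on_def C1_on_def)
  obtain E where E: "(\<tau> has_derivative blinfun_apply E) (at (\<sigma> a))"
    using \<sigma> V by (auto simp: C1_diffeo_on_def C1_on_def \<tau>_def)
  have \<tau>a: "\<tau> (\<sigma> a) = a" using inj V by (simp add: \<tau>_def)
  have "((\<sigma> \<circ> \<tau>) has_derivative (blinfun_apply D \<circ> blinfun_apply E)) (at (\<sigma> a))"
    using diff_chain_at[OF E] D \<tau>a by metis
  moreover have "((\<sigma> \<circ> \<tau>) has_derivative (\<lambda>x. x)) (at (\<sigma> a))"
    by (rule has_derivative_transform_within_open[OF has_derivative_ident op])
      (use V in \<open>auto simp: \<tau>_def f_inv_into_f\<close>)
  ultimately have DE: "blinfun_apply D \<circ> blinfun_apply E = (\<lambda>x. x)"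
    by (rule has_derivative_unique)
  then have injE: "inj (blinfun_apply E)"
    by (metis comp_apply injI)
  \<comment> \<open>The tangent space of \<open>M\<close> at \<open>a\<close>; injectivity of
    \<open>E\<close> preserves the dimension of \<open>Z\<close>.\<close>
  define T where "T = blinfun_apply E ` Z"
  have linE: "linear (blinfun_apply E)"
    using blinfun.bounded_linear_right bounded_linear.linear by blast
  have subT: "subspace T" unfolding T_def by (rule linear_subspace_image[OF linE Z(1)])
  have dimT: "dim T = DIM('a) - 1"
    unfolding T_def using dim_image_eq[OF linE, of Z] injE Z by (metis inj_on_subset subset_UNIV)
  define N where "N = {v::'a. \<forall>x\<in>T. orthogonal x v}"
  have "dim N + dim T = DIM('a)"
    using dim_subspace_orthogonal_to_vectors[OF subT subspace_UNIV] by (simp add: N_def)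
  then have dimN: "dim N = 1" using dimT DIM_positive[where 'a='a] by linarith
  have subN: "subspace N" unfolding N_def subspace_def by (auto simp: orthogonal_def inner_add_right)
  have normal: "a - p \<in> N" if p: "\<And>x. x \<in> M \<Longrightarrow> dist a p \<le> dist x p" for p
  proof -
    have "blinfun_apply E z \<bullet> (a - p) = 0" if z: "z \<in> Z" for z
    proof -
      \<comment> \<open>First-order condition along a curve through \<open>a\<close> that stays in
        \<open>M\<close> for small \<open>s\<close>, since the chart straightens \<open>M\<close> to
        \<open>Z\<close>.\<close>
      define \<phi> where "\<phi> s = (\<tau> (\<sigma> a + s *\<^sub>R z) - p) \<bullet> (\<tau> (\<sigma> a + s *\<^sub>R z) - p)" for s :: real
      have "((\<lambda>s. \<sigma> a + s *\<^sub>R z) has_derivative (\<lambda>s. s *\<^sub>R z)) (at 0)"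
        by (auto intro!: derivative_eq_intros)
      from diff_chain_at[OF this, of \<tau> E] E
      have "((\<lambda>s. \<tau> (\<sigma> a + s *\<^sub>R z)) has_derivative (\<lambda>s. s *\<^sub>R blinfun_apply E z)) (at 0)"
        by (simp add: o_def blinfun.scaleR_right)
      then have "(\<phi> has_derivative (\<lambda>s. s * (2 * (blinfun_apply E z \<bullet> (a - p))))) (at 0)"
        unfolding \<phi>_def
        by (auto intro!: derivative_eq_intros simp: \<tau>a inner_commute algebra_simps)
      then have der: "DERIV \<phi> 0 :> 2 * (blinfun_apply E z \<bullet> (a - p))"
        by (simp add: has_field_derivative_def mult.commute[of _ "_ :: real"] mult_commute_abs)
      have "open ((\<lambda>s. \<sigma> a + s *\<^sub>R z) -` (\<sigma> ` V))"
        by (intro open_vimage[OF op] continuous_intros)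
      moreover have "0 \<in> (\<lambda>s. \<sigma> a + s *\<^sub>R z) -` (\<sigma> ` V)" using V(2) by simp
      ultimately obtain d where d: "d > 0" "ball 0 d \<subseteq> (\<lambda>s. \<sigma> a + s *\<^sub>R z) -` (\<sigma> ` V)"
        by (rule openE)
      have "\<phi> 0 \<le> \<phi> s" if "\<bar>0 - s\<bar> < d" for s
      proof -
        have "\<sigma> a \<in> \<sigma> ` (V \<inter> M)" using a V(2) by (intro imageI IntI)
        then have "\<sigma> a \<in> Z" unfolding im by (rule IntD1)
        then have "\<sigma> a + s *\<^sub>R z \<in> Z" using Z z by (simp add: subspace_add subspace_scale)
        moreover have "\<sigma> a + s *\<^sub>R z \<in> \<sigma> ` V" using d that by (auto simp: dist_real_def subset_iff)
        ultimately have "\<sigma> a + s *\<^sub>R z \<in> \<sigma> ` (V \<inter> M)" unfolding im by (rule IntI)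
        then obtain x where x: "x \<in> V" "x \<in> M" "\<sigma> a + s *\<^sub>R z = \<sigma> x" by auto
        then have "\<tau> (\<sigma> a + s *\<^sub>R z) = x" using inj by (simp add: \<tau>_def)
        then show ?thesis using p[OF x(2)]
          by (simp add: \<phi>_def \<tau>a dist_norm flip: power2_norm_eq_inner)
      qed
      then show ?thesis using DERIV_local_min[OF der d(1)] by simp
    qed
    then show ?thesis by (auto simp: N_def T_def orthogonal_def)
  qed
  have "span {a - p} = N"
  proof (rule subspace_dim_equal)
    show "span {a - p} \<subseteq> N" using normal[OF p] subN by (simp add: span_minimal)
    show "dim N \<le> dim (span {a - p})" using dimN ne by (simp add: dim_span)
  qed (use subN in auto)
  then show ?thesis using normal[OF q] that by (auto simp: span_singleton)
qed

section \<open>Discs of radius \<open>r\<close> touching the graph of a function of one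
  variable\<close>

text \<open>Equivalently, \<open>(x, G x)\<close> is a nearest point of the graph of \<open>G\<close> to the point over \<open>t\<close> that lies
  above the graph at distance \<open>r\<close> from it.\<close>

definition foot :: "(real \<Rightarrow> real) \<Rightarrow> real \<Rightarrow> real \<Rightarrow> real \<Rightarrow> bool" where
  "foot G r t x \<longleftrightarrow> \<bar>x - t\<bar> \<le> r \<and>
     (\<forall>z\<in>{-r..r}. G (t + z) + sqrt (r\<^sup>2 - z\<^sup>2) \<le> G x + sqrt (r\<^sup>2 - (x - t)\<^sup>2))"

lemma foot_bound:
  assumes "foot G r t x" "\<bar>z - t\<bar> \<le> r"
  shows "G z + sqrt (r\<^sup>2 - (z - t)\<^sup>2) \<le> G x + sqrt (r\<^sup>2 - (x - t)\<^sup>2)"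
proof -
  have "z - t \<in> {-r..r}" using assms(2) by auto
  then show ?thesis using assms(1) unfolding foot_def by force
qed

lemma foot_exists:
  assumes "r > 0" "continuous_on UNIV G"
  obtains x where "foot G r t x"
proof -
  have "continuous_on {-r..r} (\<lambda>z. G (t + z) + sqrt (r\<^sup>2 - z\<^sup>2))"
    by (intro continuous_intros continuous_on_compose2[OF assms(2)]) auto
  then obtain z where z: "z \<in> {-r..r}"
    "\<forall>y\<in>{-r..r}. G (t + y) + sqrt (r\<^sup>2 - y\<^sup>2) \<le> G (t + z) + sqrt (r\<^sup>2 - z\<^sup>2)"
    using continuous_attains_sup[of "{-r..r}" "\<lambda>z. G (t + z) + sqrt (r\<^sup>2 - z\<^sup>2)"] assms(1) by auto
  show ?thesis by (rule that[of "t + z"]) (use z in \<open>auto simp: foot_def\<close>)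
qed

text \<open>Over \<open>[t - r, t + r]\<close> maximality keeps the graph on or below the lower half
  of the circle of radius \<open>r\<close> about the centre over \<open>t\<close>; elsewhere the
  horizontal distance alone exceeds \<open>r\<close>.\<close>

lemma foot_exterior:
  assumes "foot G r t x"
  shows "r\<^sup>2 \<le> (z - t)\<^sup>2 + (G x + sqrt (r\<^sup>2 - (x - t)\<^sup>2) - G z)\<^sup>2"
proof (cases "\<bar>z - t\<bar> \<le> r")
  case True
  then have le: "(z - t)\<^sup>2 \<le> r\<^sup>2" using abs_le_square_iff[of "z - t" r] by auto
  have "sqrt (r\<^sup>2 - (z - t)\<^sup>2) \<le> G x + sqrt (r\<^sup>2 - (x - t)\<^sup>2) - G z"
    using foot_bound[OF assms True] by simp
  moreover have "0 \<le> sqrt (r\<^sup>2 - (z - t)\<^sup>2)" using le by simp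
  ultimately have "(sqrt (r\<^sup>2 - (z - t)\<^sup>2))\<^sup>2 \<le> (G x + sqrt (r\<^sup>2 - (x - t)\<^sup>2) - G z)\<^sup>2"
    by (rule power_mono)
  then show ?thesis using le by simp
next
  case False
  have "0 \<le> r" using assms unfolding foot_def by linarith
  then have "r\<^sup>2 \<le> (z - t)\<^sup>2" using abs_le_square_iff[of r "z - t"] False by auto
  then show ?thesis by (simp add: add_increasing2)
qed

text \<open>The squared distance from the centre to the graph is minimal at \<open>x\<close>, so its
  derivative vanishes there and the centre lies on the normal at \<open>x\<close>. Hence the foot
  determines the centre, and the vertical offset is strictly positive.\<close>

lemma foot_center:
  assumes "foot G r t x" "r > 0" "DERIV G x :> H"
  shows "x - t = sqrt (r\<^sup>2 - (x - t)\<^sup>2) * H" "sqrt (r\<^sup>2 - (x - t)\<^sup>2) = r / sqrt (1 + H\<^sup>2)"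
proof -
  define s where "s = sqrt (r\<^sup>2 - (x - t)\<^sup>2)"
  have "\<bar>x - t\<bar> \<le> \<bar>r\<bar>" using assms unfolding foot_def by auto
  then have "(x - t)\<^sup>2 \<le> r\<^sup>2" by (simp only: abs_le_square_iff)
  then have s2: "s\<^sup>2 = r\<^sup>2 - (x - t)\<^sup>2" and s0: "0 \<le> s" by (simp_all add: s_def)
  have der: "DERIV (\<lambda>z. (z - t)\<^sup>2 + (G x + s - G z)\<^sup>2) x :> 2 * (x - t) - 2 * s * H"
    by (auto intro!: derivative_eq_intros assms(3))
  have min: "\<forall>z. \<bar>x - z\<bar> < 1 \<longrightarrow> (x - t)\<^sup>2 + (G x + s - G x)\<^sup>2 \<le> (z - t)\<^sup>2 + (G x + s - G z)\<^sup>2"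
    using foot_exterior[OF assms(1)] s2 by (simp flip: s_def)
  from DERIV_local_min[OF der _ min] have eq: "x - t = s * H" by simp
  then show "x - t = sqrt (r\<^sup>2 - (x - t)\<^sup>2) * H" by (simp add: s_def)
  have "s\<^sup>2 * (1 + H\<^sup>2) = r\<^sup>2" using s2 unfolding eq by (simp add: algebra_simps)
  then have "sqrt (s\<^sup>2 * (1 + H\<^sup>2)) = r" using assms(2) by simp
  then have "s * sqrt (1 + H\<^sup>2) = r" using s0 by (simp add: real_sqrt_mult)
  moreover have "sqrt (1 + H\<^sup>2) > 0" by (simp add: add_pos_nonneg)
  ultimately have "s = r / sqrt (1 + H\<^sup>2)" by (simp add: field_simps)
  then show "sqrt (r\<^sup>2 - (x - t)\<^sup>2) = r / sqrt (1 + H\<^sup>2)" by (simp add: s_def)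
qed

lemma foot_center_unique:
  assumes "foot G r t x" "foot G r t' x" "r > 0" "DERIV G x :> H"
  shows "t = t'"
  using foot_center[OF assms(1,3,4)] foot_center[OF assms(2-4)] by simp

text \<open>Expanding the exterior condition with the centre on the normal gives
  \<open>2 * s * (e - H x * d) \<le> d\<^sup>2 + e\<^sup>2\<close>, and
  \<open>\<bar>e\<bar> \<le> K * \<bar>d\<bar>\<close>. The constant is uniform in \<open>x\<close>
  because the slope bound forces \<open>s \<ge> r / sqrt (1 + K\<^sup>2)\<close>.\<close>

lemma foot_one_sided_bound:
  assumes ft: "foot G r t x" and r: "r > 0" and G: "\<And>x. DERIV G x :> H x" and K: "\<And>x. \<bar>H x\<bar> \<le> K"
  shows "2 * r * (G z - G x - H x * (z - x)) \<le> (1 + K\<^sup>2) * sqrt (1 + K\<^sup>2) * (z - x)\<^sup>2"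
proof -
  define s where "s = sqrt (r\<^sup>2 - (x - t)\<^sup>2)"
  define d where "d = z - x"
  define e where "e = G z - G x"
  have c: "x - t = s * H x" "s = r / sqrt (1 + (H x)\<^sup>2)"
    using foot_center[OF ft r G] by (auto simp: s_def)
  have K0: "K \<ge> 0" using K[of 0] by linarith
  have HK: "(H x)\<^sup>2 \<le> K\<^sup>2" using K[of x] K0 abs_le_square_iff[of "H x" K] by simp
  have "\<bar>x - t\<bar> \<le> \<bar>r\<bar>" using ft r unfolding foot_def by auto
  then have "(x - t)\<^sup>2 \<le> r\<^sup>2" by (simp only: abs_le_square_iff)
  then have s2: "s\<^sup>2 + (x - t)\<^sup>2 = r\<^sup>2" by (simp add: s_def)
  have s0: "s > 0" using c r by (simp add: add_pos_nonneg)
  have eK: "\<bar>e\<bar> \<le> K * \<bar>d\<bar>"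
    using field_differentiable_bound[of UNIV G H K x z] G K
    by (simp add: e_def d_def abs_minus_commute)
  then have "e\<^sup>2 \<le> (K * d)\<^sup>2" using K0 abs_le_square_iff[of e "K * d"] by (simp add: abs_mult)
  moreover have "0 \<le> d\<^sup>2 + e\<^sup>2 + 2 * d * (x - t) - 2 * s * e"
    using foot_exterior[OF ft, of z] s2
    unfolding s_def[symmetric] d_def e_def by (simp add: power2_eq_square algebra_simps)
  ultimately have 1: "2 * s * (e - H x * d) \<le> (1 + K\<^sup>2) * d\<^sup>2"
    unfolding c(1) by (simp add: power_mult_distrib algebra_simps)
  have "r \<le> s * sqrt (1 + K\<^sup>2)"
  proof -
    have "sqrt (1 + (H x)\<^sup>2) \<le> sqrt (1 + K\<^sup>2)" using HK by simp
    moreover have "sqrt (1 + (H x)\<^sup>2) > 0" by (simp add: add_pos_nonneg)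
    ultimately show ?thesis using r unfolding c(2) by (simp add: field_simps)
  qed
  show ?thesis
  proof (cases "e - H x * d \<le> 0")
    case True
    then have "2 * r * (e - H x * d) \<le> 0" using r by (simp add: mult_nonneg_nonpos)
    also have "0 \<le> (1 + K\<^sup>2) * sqrt (1 + K\<^sup>2) * d\<^sup>2" by simp
    finally show ?thesis by (simp add: e_def d_def)
  next
    case False
    then have "2 * r * (e - H x * d) \<le> 2 * (s * sqrt (1 + K\<^sup>2)) * (e - H x * d)"
      using \<open>r \<le> _\<close> by (intro mult_right_mono) auto
    also have "\<dots> = sqrt (1 + K\<^sup>2) * (2 * s * (e - H x * d))" by simp
    also have "\<dots> \<le> sqrt (1 + K\<^sup>2) * ((1 + K\<^sup>2) * d\<^sup>2)" using 1 by (intro mult_left_mono) auto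
    finally show ?thesis by (simp add: e_def d_def algebra_simps)
  qed
qed

text \<open>The parameters with a foot at most \<open>q\<close> and those with a foot at least
  \<open>q\<close> form closed sets covering \<open>[a, b]\<close>, nonempty by \<open>t1\<close>
  and \<open>t2\<close>. Connectedness yields a common \<open>t\<close>; its two feet coincide by
  uniqueness, so both equal \<open>q\<close>.\<close>

lemma foot_fills_interval:
  assumes r: "r > 0" and G: "continuous_on UNIV G"
    and uniq: "\<And>t x y. t \<in> {a..b} \<Longrightarrow> foot G r t x \<Longrightarrow> foot G r t y \<Longrightarrow> x = y"
    and t1: "t1 \<in> {a..b}" "foot G r t1 x1" and t2: "t2 \<in> {a..b}" "foot G r t2 x2"
    and q: "x1 \<le> q" "q \<le> x2"
  shows "\<exists>t\<in>{a..b}. foot G r t q"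
proof -
  define F where "F = {p. fst p \<in> {a..b} \<and> foot G r (fst p) (snd p)}"
  have F: "F = {p. a \<le> fst p} \<inter> {p. fst p \<le> b} \<inter> {p. \<bar>snd p - fst p\<bar> \<le> r} \<inter>
      (\<Inter>z\<in>{-r..r}. {p. G (fst p + z) + sqrt (r\<^sup>2 - z\<^sup>2)
        \<le> G (snd p) + sqrt (r\<^sup>2 - (snd p - fst p)\<^sup>2)})"
    by (auto simp: F_def foot_def)
  have "closed F" unfolding F
    by (intro closed_Int closed_INT ballI closed_Collect_le continuous_intros
        continuous_on_compose2[OF G]) auto
  \<comment> \<open>Boundedness makes \<open>F\<close> compact, which is what keeps its projections
    to the \<open>t\<close>-axis closed.\<close>
  moreover have "F \<subseteq> cbox (a, a - r) (b, b + r)"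
    unfolding F_def foot_def by (auto simp: cbox_Pair_eq)
  ultimately have cF: "compact F"
    using bounded_cbox bounded_subset compact_eq_bounded_closed by blast
  have cl: "closed (fst ` (F \<inter> {p. snd p \<le> q}))" "closed (fst ` (F \<inter> {p. q \<le> snd p}))"
    by (intro compact_imp_closed compact_continuous_image compact_Int_closed cF closed_Collect_le
        continuous_intros)+
  define A B where "A = fst ` (F \<inter> {p. snd p \<le> q})" and "B = fst ` (F \<inter> {p. q \<le> snd p})"
  have "{a..b} \<subseteq> A \<union> B"
  proof
    fix t assume t: "t \<in> {a..b}"
    obtain x where "foot G r t x" using foot_exists[OF r G] .
    then have "(t, x) \<in> F" using t by (simp add: F_def)
    then show "t \<in> A \<union> B" unfolding A_def B_def by (cases "x \<le> q") force+
  qed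
  moreover have "t1 \<in> A"
    using t1 q by (auto simp: A_def F_def image_iff intro!: bexI[of _ "(t1, x1)"])
  moreover have "t2 \<in> B"
    using t2 q by (auto simp: B_def F_def image_iff intro!: bexI[of _ "(t2, x2)"])
  ultimately have "A \<inter> B \<inter> {a..b} \<noteq> {}"
    using connected_closedD[OF connected_Icc, of A B a b] cl t1(1) t2(1)
    unfolding A_def[symmetric] B_def[symmetric] by blast
  then obtain t where t: "t \<in> {a..b}" "t \<in> A" "t \<in> B" by blast
  obtain x where x: "foot G r t x" "x \<le> q" using t(2) by (auto simp: A_def F_def)
  obtain y where y: "foot G r t y" "q \<le> y" using t(3) by (auto simp: B_def F_def)
  have "x = y" by (rule uniq[OF t(1) x(1) y(1)])
  then have "q = x" using x(2) y(2) by simp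
  then show ?thesis using t(1) x(1) by blast
qed

text \<open>Were feet unique over \<open>[a, b]\<close>, every point between a foot of
  \<open>a\<close> and a foot of \<open>b\<close> would be a foot, and the one-sided bounds would
  limit the slopes of \<open>H\<close> from above, against \<open>osc\<close>.\<close>

lemma two_feet_dense:
  assumes r: "r > 0" and ab: "a < b" and G: "\<And>x. DERIV G x :> H x" and K: "\<And>x. \<bar>H x\<bar> \<le> K"
    and osc: "\<And>C a b. a < b \<Longrightarrow> \<exists>x y. a < x \<and> x < y \<and> y < b \<and> H y - H x > C * (y - x)"
  shows "\<exists>t\<in>{a..b}. \<exists>x y. foot G r t x \<and> foot G r t y \<and> x \<noteq> y"
proof (rule ccontr)
  assume no: "\<not> ?thesis"
  have cont: "continuous_on UNIV G"
    using G DERIV_isCont continuous_at_imp_continuous_on by blast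
  obtain xa where xa: "foot G r a xa" using foot_exists[OF r cont] .
  obtain xb where xb: "foot G r b xb" using foot_exists[OF r cont] .
  have "xa \<noteq> xb" using foot_center_unique[OF xa _ r G] xb ab by blast
  then have "min xa xb < max xa xb" by auto
  \<comment> \<open>Adding the one-sided bounds at \<open>x\<close> and \<open>y\<close> cancels the
    values of \<open>G\<close> and leaves \<open>H y - H x \<le> C * (y - x)\<close>.\<close>
  define C where "C = (1 + K\<^sup>2) * sqrt (1 + K\<^sup>2) / r"
  from osc[OF \<open>min xa xb < max xa xb\<close>, of C] obtain x y
    where xy: "min xa xb < x" "x < y" "y < max xa xb" "H y - H x > C * (y - x)" by blast
  have "\<exists>t\<in>{a..b}. foot G r t q" if "min xa xb \<le> q" "q \<le> max xa xb" for q
  proof (cases "xa \<le> xb")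
    case True
    then show ?thesis
      using foot_fills_interval[OF r cont _ _ xa _ xb, of a b q] no ab that by auto
  next
    case False
    then show ?thesis
      using foot_fills_interval[OF r cont _ _ xb _ xa, of a b q] no ab that by auto
  qed
  then obtain t t' where "foot G r t x" "foot G r t' y"
    using xy by (metis less_le_trans less_imp_le)
  from foot_one_sided_bound[OF this(1) r G K, of y] foot_one_sided_bound[OF this(2) r G K, of x]
  have "2 * r * ((H y - H x) * (y - x)) \<le> 2 * ((1 + K\<^sup>2) * sqrt (1 + K\<^sup>2) * (y - x)\<^sup>2)"
    by (simp add: algebra_simps power2_commute[of x y])
  then have "(H y - H x) * (y - x) \<le> C * (y - x) * (y - x)"
    using r by (simp add: C_def field_simps power2_eq_square)
  then show False using xy by simp
qed

section \<open>A Weierstrass series and its antiderivative\<close>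

text \<open>The ratio \<open>1/2\<close> gives uniform convergence; the frequency ratio
  \<open>16\<close> is even, which makes the later terms constant on the grid of mesh
  \<open>1 / 16 ^ N\<close>; their product \<open>8\<close> exceeds one and drives slopes to
  infinity.\<close>

definition weier :: "real \<Rightarrow> real" where
  "weier x = (\<Sum>k. (1/2) ^ k * cos (16 ^ k * pi * x))"

definition weier_int :: "real \<Rightarrow> real" where
  "weier_int x = (\<Sum>k. (1/2) ^ k / (16 ^ k * pi) * sin (16 ^ k * pi * x))"

lemma weier_term_bound: "norm ((1/2) ^ k * cos (16 ^ k * pi * x) :: real) \<le> (1/2) ^ k"
  by (simp add: abs_mult mult_left_le)

lemma summable_half: "summable (\<lambda>k. (1/2 :: real) ^ k)"
  by (simp add: summable_geometric)

lemma summable_weier: "summable (\<lambda>k. (1/2) ^ k * cos (16 ^ k * pi * x) :: real)"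
  by (rule summable_comparison_test'[OF summable_half weier_term_bound])

lemma weier_uniform:
  "uniformly_convergent_on UNIV (\<lambda>n x. \<Sum>k<n. (1/2) ^ k * cos (16 ^ k * pi * x) :: real)"
  by (rule Weierstrass_m_test_ev[OF _ summable_half, THEN uniformly_convergentI])
    (use weier_term_bound in auto)

lemma DERIV_weier_int: "DERIV weier_int x :> weier x"
  unfolding weier_def weier_int_def
  by (rule has_field_derivative_series'(2)[OF convex_UNIV _ weier_uniform, of _ 0])
    (auto intro!: derivative_eq_intros)

lemma continuous_weier: "continuous_on UNIV weier"
proof -
  have "uniform_limit UNIV (\<lambda>n x. \<Sum>k<n. (1/2) ^ k * cos (16 ^ k * pi * x)) weier sequentially"
    using weier_uniform
    by (simp add: uniformly_convergent_uniform_limit_iff suminf_eq_lim weier_def[abs_def])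
  then show ?thesis
    by (rule uniform_limit_theorem[rotated]) (auto intro!: always_eventually continuous_intros)
qed

lemma abs_weier_le: "\<bar>weier x\<bar> \<le> 2"
proof -
  have "norm (weier x) \<le> (\<Sum>k. (1/2 :: real) ^ k)"
    unfolding weier_def by (rule norm_suminf_le[OF weier_term_bound summable_half])
  then show ?thesis by (simp add: suminf_geometric)
qed

lemma abs_cos_diff_le: "\<bar>cos x - cos y\<bar> \<le> \<bar>x - y :: real\<bar>"
  using field_differentiable_bound[of UNIV cos "\<lambda>x. - sin x" 1 y x]
  by (auto intro!: derivative_eq_intros)

text \<open>Between neighbouring grid points the terms beyond \<open>N\<close> do not change, term
  \<open>N\<close> flips its sign and contributes \<open>2 * (1/2) ^ N\<close> in the direction
  \<open>\<epsilon>\<close>, and the earlier terms together move by at most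
  \<open>(1/2) ^ N\<close>.\<close>

lemma weier_grid_step:
  fixes m :: int and N :: nat
  defines "x \<equiv> of_int m / 16 ^ N" and "y \<equiv> (of_int m + 1) / 16 ^ N"
  assumes \<epsilon>: "\<epsilon> = (if even m then -1 else 1)"
  shows "\<epsilon> * (weier y - weier x) \<ge> (1/2) ^ N"
proof -
  define d where "d k = (1/2) ^ k * cos (16 ^ k * pi * y) - (1/2) ^ k * cos (16 ^ k * pi * x)" for k
  have high: "cos (16 ^ k * pi * (of_int j / 16 ^ N)) = 1" if "k > N" for k and j :: int
  proof -
    obtain l where l: "k = Suc N + l" using \<open>k > N\<close> less_imp_Suc_add by force
    have "16 ^ k * pi * (of_int j / 16 ^ N) = pi * of_int (16 ^ Suc l * j)"
      by (simp add: l power_add)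
    then show ?thesis by (simp only: cos_npi_int) simp
  qed
  have "weier y - weier x = (\<Sum>k. d k)"
    unfolding weier_def d_def by (rule suminf_diff) (rule summable_weier)+
  also have "\<dots> = (\<Sum>k<Suc N. d k)"
  proof (rule suminf_finite)
    fix k assume "k \<notin> {..<Suc N}"
    then have "k > N" by auto
    then show "d k = 0" using high[of k m] high[of k "m + 1"] by (simp add: d_def x_def y_def)
  qed simp
  finally have sum: "weier y - weier x = (\<Sum>k<N. d k) + d N" by simp
  have "cos (16 ^ N * pi * y) = cos (pi * of_int (m + 1))"
       "cos (16 ^ N * pi * x) = cos (pi * of_int m)"
    by (simp_all add: x_def y_def)
  then have main: "\<epsilon> * d N = 2 * (1/2) ^ N"
    unfolding d_def cos_npi_int using \<epsilon> by (auto simp del: of_int_add)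
  \<comment> \<open>Cosine is 1-Lipschitz, so term \<open>k\<close> moves by at most
    \<open>8 ^ k * pi / 16 ^ N\<close>; with \<open>pi < 4\<close> the geometric sum stays below
    \<open>4/7 * (1/2) ^ N\<close>.\<close>
  have "\<bar>\<Sum>k<N. d k\<bar> \<le> (\<Sum>k<N. 8 ^ k * (4 / 16 ^ N))"
  proof (rule sum_norm_le[where 'a = real, simplified real_norm_def])
    fix k
    have "\<bar>d k\<bar> = (1/2) ^ k * \<bar>cos (16 ^ k * pi * y) - cos (16 ^ k * pi * x)\<bar>"
      by (simp add: d_def abs_mult flip: right_diff_distrib)
    also have "\<dots> \<le> (1/2) ^ k * \<bar>16 ^ k * pi * y - 16 ^ k * pi * x\<bar>"
      by (intro mult_left_mono abs_cos_diff_le) auto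
    also have "\<dots> = (1/2) ^ k * 16 ^ k * (pi / 16 ^ N)"
      by (simp add: x_def y_def field_simps)
    also have "\<dots> = 8 ^ k * (pi / 16 ^ N)"
      by (simp flip: power_mult_distrib)
    also have "\<dots> \<le> 8 ^ k * (4 / 16 ^ N)"
      using pi_less_4 by (intro mult_left_mono divide_right_mono) auto
    finally show "\<bar>d k\<bar> \<le> 8 ^ k * (4 / 16 ^ N)" .
  qed
  also have "\<dots> = (\<Sum>k<N. 8 ^ k) * (4 / 16 ^ N)" by (rule sum_distrib_right[symmetric])
  also have "\<dots> = (8 ^ N - 1) / 7 * (4 / 16 ^ N)" by (simp add: geometric_sum)
  also have "\<dots> \<le> 8 ^ N * (1 / 16 ^ N)" by (simp add: field_simps)
  also have "\<dots> = (1/2 :: real) ^ N" by (simp flip: power_divide add: power_one_over)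
  finally have "\<bar>\<epsilon> * (\<Sum>k<N. d k)\<bar> \<le> (1/2) ^ N" using \<epsilon> by (auto simp: abs_mult)
  then show ?thesis unfolding sum distrib_left main by linarith
qed

text \<open>A change of at least \<open>(1/2) ^ N\<close> over a cell of length
  \<open>1 / 16 ^ N\<close> is a slope of size at least \<open>8 ^ N\<close>; the parity of the cell
  selects its sign.\<close>

lemma weier_oscillates:
  fixes \<epsilon> :: real
  assumes "\<epsilon> \<in> {-1, 1}" "a < b"
  shows "\<exists>x y. a < x \<and> x < y \<and> y < b \<and> \<epsilon> * weier y - \<epsilon> * weier x > C * (y - x)"
proof -
  \<comment> \<open>Three cells must fit into \<open>(a, b)\<close>: up to two to pass
    \<open>a\<close> and reach the right parity, one for the step itself.\<close>
  obtain N1 where N1: "3 / (b - a) < 16 ^ N1" using real_arch_pow[of 16 "3 / (b - a)"] by auto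
  obtain N2 where N2: "C < 8 ^ N2" using real_arch_pow[of 8 C] by auto
  define N where "N = max N1 N2"
  have "(16 :: real) ^ N1 \<le> 16 ^ N" "(8 :: real) ^ N2 \<le> 8 ^ N"
    by (auto simp: N_def intro!: power_increasing)
  then have "3 / (b - a) < 16 ^ N" and "C < 8 ^ N" using N1 N2 by linarith+
  then have N: "3 < (b - a) * 16 ^ N" "C < 8 ^ N"
    using assms(2) by (simp_all add: pos_divide_less_eq mult.commute)
  define m0 where "m0 = \<lfloor>a * 16 ^ N\<rfloor> + 1"
  define m where "m = (if (\<epsilon> = -1) = even m0 then m0 else m0 + 1)"
  have par: "\<epsilon> = (if even m then -1 else 1)" using assms(1) by (auto simp: m_def)
  have "a * 16 ^ N < of_int m0" "of_int m0 \<le> a * 16 ^ N + 1" unfolding m0_def by linarith+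
  then have m: "a * 16 ^ N < of_int m" "of_int m \<le> a * 16 ^ N + 2" by (auto simp: m_def)
  define x y :: real where "x = of_int m / 16 ^ N" and "y = (of_int m + 1) / 16 ^ N"
  have "a < x" "x < y" "y < b"
    using m N(1) by (simp_all add: x_def y_def field_simps)
  moreover have "C * (y - x) < \<epsilon> * weier y - \<epsilon> * weier x"
  proof -
    have "C * (y - x) = C * (1 / 16 ^ N)" by (simp add: x_def y_def field_simps)
    also have "\<dots> < 8 ^ N * (1 / 16 ^ N)" using N(2) by (intro mult_strict_right_mono) auto
    also have "\<dots> = (1/2 :: real) ^ N" by (simp flip: power_divide add: power_one_over)
    also have "\<dots> \<le> \<epsilon> * (weier y - weier x)"
      unfolding x_def y_def by (rule weier_grid_step[OF par])
    finally show ?thesis by (simp add: algebra_simps)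
  qed
  ultimately show ?thesis by blast
qed

section \<open>C^1 graphs as hypersurfaces\<close>

text \<open>Vertical shears: \<open>c = -1\<close> flattens the graph of \<open>f\<close> and
  \<open>c = 1\<close> undoes this, giving a global chart and its inverse.\<close>

lemma C1_on_id_plus_vertical:
  fixes f :: "'a::euclidean_space \<Rightarrow> real"
  assumes "C1_on f UNIV"
  shows "C1_on (\<lambda>p. (fst p, snd p + c * f (fst p))) UNIV"
proof -
  obtain f' :: "'a \<Rightarrow> 'a \<Rightarrow>\<^sub>L real" where f': "\<And>x. (f has_derivative blinfun_apply (f' x)) (at x)"
    and cont: "continuous_on UNIV f'"
    using assms by (auto simp: C1_on_def)
  \<comment> \<open>The derivative is assembled from bounded linear maps, \<open>J\<close> being the
    inclusion of the vertical axis, so that its operator-norm continuity reduces to that of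
    \<open>f'\<close>.\<close>
  define J :: "real \<Rightarrow>\<^sub>L ('a \<times> real)" where "J = Blinfun (\<lambda>t. (0, t))"
  have J: "blinfun_apply J t = (0, t)" for t
    unfolding J_def by (subst bounded_linear_Blinfun_apply) (auto intro!: bounded_linear_intros)
  define D :: "'a \<times> real \<Rightarrow> ('a \<times> real) \<Rightarrow>\<^sub>L ('a \<times> real)" where
    "D p = id_blinfun + c *\<^sub>R (J o\<^sub>L (f' (fst p) o\<^sub>L fst_blinfun))" for p
  have Dapp: "blinfun_apply (D p) v = (fst v, snd v + c * f' (fst p) (fst v))" for p v
    by (simp add: D_def J plus_blinfun.rep_eq scaleR_blinfun.rep_eq prod_eq_iff
        fst_blinfun.rep_eq id_blinfun.rep_eq)
  have "((\<lambda>p. (fst p, snd p + c * f (fst p))) has_derivative blinfun_apply (D p)) (at p)" for p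
    unfolding Dapp[abs_def]
    by (auto intro!: derivative_eq_intros has_derivative_compose[OF _ f'])
  moreover have "continuous_on UNIV D" unfolding D_def
    by (intro continuous_intros continuous_on_compose2[OF cont]) auto
  ultimately show ?thesis unfolding C1_on_def by blast
qed

lemma C1_hypersurface_graph:
  fixes f :: "real ^ 'm \<Rightarrow> real"
  assumes "C1_on f UNIV"
  shows "C1_hypersurface (graph_of f)"
  unfolding C1_hypersurface_def
proof
  fix a assume "a \<in> graph_of f"
  define \<sigma> where "\<sigma> p = (fst p, snd p + (-1) * f (fst p))" for p
  define \<tau> where "\<tau> p = (fst p, snd p + 1 * f (fst p))" for p
  have inv: "\<tau> (\<sigma> p) = p" "\<sigma> (\<tau> p) = p" for p by (auto simp: \<sigma>_def \<tau>_def)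
  have inj: "inj \<sigma>" by (rule inj_on_inverseI[of _ \<tau>]) (rule inv(1))
  have surj: "range \<sigma> = UNIV" by (rule surjI) (rule inv(2))
  have "inv_into UNIV \<sigma> = \<tau>" by (rule inv_equality) (rule inv)+
  then have "C1_diffeo_on \<sigma> UNIV"
    using inj surj C1_on_id_plus_vertical[OF assms, of "-1"] C1_on_id_plus_vertical[OF assms, of 1]
    unfolding C1_diffeo_on_def by (simp add: \<sigma>_def[abs_def] \<tau>_def[abs_def])
  moreover have "\<sigma> ` graph_of f = UNIV \<times> {0}"
  proof -
    have "(y, 0) \<in> \<sigma> ` graph_of f" for y
      by (rule image_eqI[of _ _ "(y, f y)"]) (auto simp: \<sigma>_def graph_of_def)
    then show ?thesis by (auto simp: \<sigma>_def graph_of_def)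
  qed
  moreover have "subspace (UNIV \<times> {0} :: ((real ^ 'm) \<times> real) set)"
    by (intro subspace_Times) auto
  moreover have "dim (UNIV \<times> {0} :: ((real ^ 'm) \<times> real) set) = DIM((real ^ 'm) \<times> real) - 1"
    by (subst dim_Times) auto
  ultimately show "\<exists>V Z \<sigma>. open V \<and> a \<in> V \<and> subspace Z \<and> dim Z = DIM((real ^ 'm) \<times> real) - 1 \<and>
      C1_diffeo_on \<sigma> V \<and> \<sigma> ` (V \<inter> graph_of f) = Z \<inter> \<sigma> ` V"
    using surj by (intro exI[of _ UNIV] exI[of _ "UNIV \<times> {0}"] exI[of _ \<sigma>]) auto
qed

lemma C1_on_component:
  assumes "\<And>x. DERIV g x :> h x" "continuous_on UNIV h"
  shows "C1_on (\<lambda>y :: real ^ 'm. g (y $ i)) UNIV"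
proof -
  define P :: "(real ^ 'm) \<Rightarrow>\<^sub>L real" where "P = Blinfun (\<lambda>v. v $ i)"
  have P: "blinfun_apply P v = v $ i" for v
    unfolding P_def by (subst bounded_linear_Blinfun_apply) (auto intro!: bounded_linear_intros)
  have "((\<lambda>y. g (y $ i)) has_derivative blinfun_apply (h (y $ i) *\<^sub>R P)) (at y)" for y :: "real ^ 'm"
  proof -
    have "((\<lambda>y :: real ^ 'm. y $ i) has_derivative (\<lambda>v. v $ i)) (at y)"
      by (rule bounded_linear_imp_has_derivative) (rule bounded_linear_vec_nth)
    from has_derivative_compose[OF this assms(1)[of "y $ i", unfolded has_field_derivative_def]]
    show ?thesis by (simp add: P scaleR_blinfun.rep_eq)
  qed
  moreover have "continuous_on UNIV (\<lambda>y :: real ^ 'm. h (y $ i) *\<^sub>R P)"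
    by (intro continuous_intros continuous_on_compose2[OF assms(2)]) auto
  ultimately show ?thesis
    unfolding C1_on_def by (intro exI[of _ "\<lambda>y. h (y $ i) *\<^sub>R P"]) blast
qed

section \<open>Level sets of the distance to the graph\<close>

lemma dist_Pair_sq: "(dist (u, v) (u', v'))\<^sup>2 = (dist u u')\<^sup>2 + (dist v v')\<^sup>2"
  by (simp add: dist_Pair_Pair)

lemma dist_add_axis: "dist y (y + c *\<^sub>R axis i 1) = \<bar>c\<bar>" for y :: "real ^ 'm"
  by (simp add: dist_norm)

text \<open>The graph depends only on coordinate \<open>i\<close>, and differences in the other
  coordinates only add to the distance, so the planar exterior condition suffices. The sign
  \<open>\<epsilon>\<close> is the side of the graph; reflection reduces the lower side to the upper
  one.\<close>

lemma infdist_foot: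
  fixes y :: "real ^ 'm" and g :: "real \<Rightarrow> real" and i
  defines "Sg \<equiv> graph_of (\<lambda>y :: real ^ 'm. g (y $ i))"
  assumes ft: "foot (\<lambda>x. \<epsilon> * g x) r (y $ i) x" and \<epsilon>: "\<epsilon> \<in> {-1, 1}" and r: "r > 0"
  defines "a \<equiv> (y, g x + \<epsilon> * sqrt (r\<^sup>2 - (x - y $ i)\<^sup>2))"
    and "p \<equiv> (y + (x - y $ i) *\<^sub>R axis i 1, g x)"
  shows "p \<in> Sg" "dist a p = r" "infdist a Sg = r"
proof -
  show p: "p \<in> Sg" by (auto simp: p_def Sg_def graph_of_def axis_def)
  have "\<bar>x - y $ i\<bar> \<le> \<bar>r\<bar>" using ft r unfolding foot_def by auto
  then have le: "(x - y $ i)\<^sup>2 \<le> r\<^sup>2" by (simp only: abs_le_square_iff)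
  have \<epsilon>2: "\<epsilon>\<^sup>2 = 1" "\<epsilon> * \<epsilon> = 1" using \<epsilon> by auto
  have "(dist a p)\<^sup>2 = r\<^sup>2"
    using le \<epsilon>2 by (simp add: dist_Pair_sq a_def p_def dist_add_axis dist_real_def power_mult_distrib)
  then show d: "dist a p = r" using r by (simp add: power2_eq_iff_nonneg)
  have ge: "r \<le> dist a b" if "b \<in> Sg" for b
  proof -
    obtain y' where b: "b = (y', g (y' $ i))" using \<open>b \<in> Sg\<close> by (auto simp: Sg_def graph_of_def)
    have "r\<^sup>2 \<le> (y' $ i - y $ i)\<^sup>2
        + (\<epsilon> * g x + sqrt (r\<^sup>2 - (x - y $ i)\<^sup>2) - \<epsilon> * g (y' $ i))\<^sup>2"
      by (rule foot_exterior[OF ft])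
    also have "(y' $ i - y $ i)\<^sup>2 \<le> (dist y y')\<^sup>2"
      using dist_vec_nth_le[of y i y'] by (simp add: abs_le_square_iff[symmetric] dist_real_def abs_minus_commute)
    also have "\<epsilon> * g x + sqrt (r\<^sup>2 - (x - y $ i)\<^sup>2) - \<epsilon> * g (y' $ i) = \<epsilon> * (snd a - snd b)"
      using \<epsilon>2 by (simp add: a_def b distrib_left right_diff_distrib flip: mult.assoc)
    also have "(\<epsilon> * (snd a - snd b))\<^sup>2 = (dist (snd a) (snd b))\<^sup>2"
      using \<epsilon>2 by (simp add: power_mult_distrib dist_real_def)
    finally have "r\<^sup>2 \<le> (dist a b)\<^sup>2" by (simp add: a_def b dist_Pair_sq)
    then show ?thesis by (rule power2_le_imp_le) simp
  qed
  show "infdist a Sg = r"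
  proof (rule antisym)
    show "infdist a Sg \<le> r" using infdist_le[OF p, of a] d by simp
    show "r \<le> infdist a Sg"
      using p ge by (subst infdist_notempty) (auto intro!: cINF_greatest)
  qed
qed

text \<open>Converse of \<open>infdist_foot\<close>: a nearest point exists since the graph is
  closed, its coordinate \<open>i\<close> is the foot, and \<open>\<epsilon>\<close> records the
  side on which \<open>(y, S)\<close> lies.\<close>

lemma infdist_graph_foot:
  fixes y :: "real ^ 'm" and g :: "real \<Rightarrow> real"
  assumes inf: "infdist (y, S) (graph_of (\<lambda>y :: real ^ 'm. g (y $ i))) = r" and r: "r > 0"
    and g: "continuous_on UNIV g"
  obtains \<epsilon> x where "\<epsilon> \<in> {-1, 1}" "foot (\<lambda>x. \<epsilon> * g x) r (y $ i) x"
    "S = g x + \<epsilon> * sqrt (r\<^sup>2 - (x - y $ i)\<^sup>2)"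
proof -
  define t where "t = y $ i"
  define Sg where "Sg = graph_of (\<lambda>y :: real ^ 'm. g (y $ i))"
  have mem: "(y', g (y' $ i)) \<in> Sg" for y' by (auto simp: Sg_def graph_of_def)
  have "Sg = {p. snd p = g (fst p $ i)}" by (auto simp: Sg_def graph_of_def)
  then have "closed Sg"
    by (simp only:) (intro closed_Collect_eq continuous_intros continuous_on_compose2[OF g], auto)
  moreover have "Sg \<noteq> {}" using mem by blast
  ultimately obtain p where "p \<in> Sg" "infdist (y, S) Sg = dist (y, S) p"
    by (rule infdist_attains_inf)
  then have "p \<in> Sg" "dist (y, S) p = r" using inf by (simp_all add: Sg_def)
  then obtain y' where y': "dist (y, S) (y', g (y' $ i)) = r" by (auto simp: Sg_def graph_of_def)
  define x where "x = y' $ i"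
  have far: "r\<^sup>2 \<le> (q - t)\<^sup>2 + (S - g q)\<^sup>2" for q
  proof -
    have "(y + (q - t) *\<^sub>R axis i 1) $ i = q" by (simp add: t_def axis_def)
    then have "(y + (q - t) *\<^sub>R axis i 1, g q) \<in> Sg" using mem by metis
    from infdist_le[OF this, of "(y, S)"] have "r \<le> dist (y, S) (y + (q - t) *\<^sub>R axis i 1, g q)"
      using inf by (simp add: Sg_def)
    then have "r\<^sup>2 \<le> (dist (y, S) (y + (q - t) *\<^sub>R axis i 1, g q))\<^sup>2"
      using r by (intro power_mono) auto
    then show ?thesis by (simp add: dist_Pair_sq dist_add_axis dist_real_def)
  qed
  have "S \<noteq> g t"
  proof
    assume "S = g t"
    then have "(y, S) \<in> Sg" using mem by (simp add: t_def)
    then show False using inf r by (simp add: Sg_def)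
  qed
  define \<epsilon> where "\<epsilon> = sgn (S - g t)"
  have \<epsilon>: "\<epsilon> \<in> {-1, 1}" and pos: "\<epsilon> * (S - g t) > 0"
    using \<open>S \<noteq> g t\<close> by (auto simp: \<epsilon>_def sgn_if)
  have \<epsilon>sq: "(\<epsilon> * v)\<^sup>2 = v\<^sup>2" for v using \<epsilon> by auto
  \<comment> \<open>\<open>far\<close> controls only \<open>\<bar>S - g q\<bar>\<close>; the sign
    comes from continuity. If it changed, \<open>g\<close> would take the value \<open>S\<close>
    strictly between \<open>t\<close> and \<open>q\<close>, giving a graph point closer than
    \<open>r\<close>.\<close>
  have above: "sqrt (r\<^sup>2 - (q - t)\<^sup>2) \<le> \<epsilon> * (S - g q)" if q: "\<bar>q - t\<bar> \<le> r" for q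
  proof -
    have "0 \<le> \<epsilon> * (S - g q)"
    proof (rule ccontr)
      assume neg: "\<not> ?thesis"
      define \<psi> where "\<psi> s = \<epsilon> * (S - g (t + s * (q - t)))" for s
      have "continuous_on {0..1} \<psi>" unfolding \<psi>_def
        by (intro continuous_intros continuous_on_compose2[OF g]) auto
      then obtain s where s: "0 \<le> s" "s \<le> 1" "\<psi> s = 0"
        using IVT2'[of \<psi> 1 0 0] neg pos by (auto simp: \<psi>_def)
      have "s \<noteq> 1" using s neg by (auto simp: \<psi>_def)
      then have "s < 1" using s by simp
      have "S - g (t + s * (q - t)) = 0" using s(3) \<epsilon> by (auto simp: \<psi>_def)
      then have "r\<^sup>2 \<le> (s * (q - t))\<^sup>2" using far[of "t + s * (q - t)"] by simp
      then have "r \<le> \<bar>s * (q - t)\<bar>" using r abs_le_square_iff[of r "s * (q - t)"] by simp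
      also have "\<dots> \<le> s * r" using s q by (simp add: abs_mult mult_left_mono)
      also have "\<dots> < r" using \<open>s < 1\<close> r by simp
      finally show False by simp
    qed
    moreover have "r\<^sup>2 - (q - t)\<^sup>2 \<le> (\<epsilon> * (S - g q))\<^sup>2" using far[of q] \<epsilon>sq by simp
    ultimately show ?thesis by (intro real_le_lsqrt)
  qed
  have d: "(dist y y')\<^sup>2 + (S - g x)\<^sup>2 = r\<^sup>2"
    using dist_Pair_sq[of y S y' "g x"] y' by (simp add: x_def dist_real_def)
  have "\<bar>x - t\<bar> \<le> dist y y'"
    using dist_vec_nth_le[of y i y'] by (simp add: x_def t_def dist_real_def abs_minus_commute)
  then have xt: "(x - t)\<^sup>2 \<le> (dist y y')\<^sup>2" by (simp add: abs_le_square_iff[symmetric])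
  moreover have "(dist y y')\<^sup>2 \<le> r\<^sup>2" using d by (metis le_add_same_cancel1 zero_le_power2)
  ultimately have "(x - t)\<^sup>2 \<le> r\<^sup>2" by (rule order_trans)
  then have xr: "\<bar>x - t\<bar> \<le> r" using r by (simp add: abs_le_square_iff[symmetric])
  \<comment> \<open>A priori the nearest point may differ from \<open>y\<close> in other coordinates
    too, so this is only an inequality; \<open>above\<close> supplies the reverse one.\<close>
  have "(\<epsilon> * (S - g x))\<^sup>2 \<le> r\<^sup>2 - (x - t)\<^sup>2" using d xt \<epsilon>sq by simp
  then have "\<epsilon> * (S - g x) \<le> sqrt (r\<^sup>2 - (x - t)\<^sup>2)" by (rule real_le_rsqrt)
  with above[OF xr] have eq: "\<epsilon> * (S - g x) = sqrt (r\<^sup>2 - (x - t)\<^sup>2)" by simp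
  have "foot (\<lambda>x. \<epsilon> * g x) r t x"
    unfolding foot_def
  proof (intro conjI ballI xr)
    fix z assume "z \<in> {-r..r}"
    then have "sqrt (r\<^sup>2 - z\<^sup>2) \<le> \<epsilon> * (S - g (t + z))" using above[of "t + z"] by auto
    then show "\<epsilon> * g (t + z) + sqrt (r\<^sup>2 - z\<^sup>2) \<le> \<epsilon> * g x + sqrt (r\<^sup>2 - (x - t)\<^sup>2)"
      unfolding eq[symmetric] by (simp add: algebra_simps)
  qed
  moreover have "S = g x + \<epsilon> * sqrt (r\<^sup>2 - (x - t)\<^sup>2)"
    unfolding eq[symmetric] using \<epsilon> by auto
  ultimately show ?thesis using that \<epsilon> by (simp add: t_def)
qed

text \<open>A sup-convolution inherits the Lipschitz constant: the offset \<open>x - t\<close> is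
  also admissible over \<open>t'\<close>, at the cost of shifting the argument of \<open>G\<close>
  by \<open>t' - t\<close>.\<close>

lemma foot_height_le:
  assumes "foot G r t x" "foot G r t' x'" and K: "\<And>a b. \<bar>G a - G b\<bar> \<le> K * \<bar>a - b\<bar>"
  shows "G x + sqrt (r\<^sup>2 - (x - t)\<^sup>2) \<le> G x' + sqrt (r\<^sup>2 - (x' - t')\<^sup>2) + K * \<bar>t - t'\<bar>"
proof -
  have "\<bar>x - t\<bar> \<le> r" using assms(1) by (simp add: foot_def)
  then have "G (t' + (x - t)) + sqrt (r\<^sup>2 - (x - t)\<^sup>2) \<le> G x' + sqrt (r\<^sup>2 - (x' - t')\<^sup>2)"
    using foot_bound[OF assms(2), of "t' + (x - t)"] by simp
  moreover have "\<bar>G x - G (t' + (x - t))\<bar> \<le> K * \<bar>t - t'\<bar>" using K[of x "t' + (x - t)"] by simp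
  ultimately show ?thesis by linarith
qed

text \<open>From any point of the level set in \<open>U\<close>, a small shift in coordinate
  \<open>i\<close> leads to one with two feet. The vectors to it from the two nearest points would
  be parallel, of equal length and with vertical parts of the same sign, hence equal.\<close>

lemma dist_level_not_C1_hypersurface:
  fixes g h :: "real \<Rightarrow> real" and i :: "'m::finite"
  defines "L \<equiv> dist_level (graph_of (\<lambda>y :: real ^ 'm. g (y $ i)))"
  assumes g: "\<And>x. DERIV g x :> h x" and K: "\<And>x. \<bar>h x\<bar> \<le> K"
    and osc: "\<And>\<epsilon> C a b. \<epsilon> \<in> {-1, 1} \<Longrightarrow> a < b \<Longrightarrow>
      \<exists>x y. a < x \<and> x < y \<and> y < b \<and> \<epsilon> * h y - \<epsilon> * h x > C * (y - x)"
    and r: "r > 0" and U: "open U" "U \<inter> L r \<noteq> {}"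
  shows "\<not> C1_hypersurface (U \<inter> L r)"
proof
  assume M: "C1_hypersurface (U \<inter> L r)"
  define Sg where "Sg = graph_of (\<lambda>y :: real ^ 'm. g (y $ i))"
  have L: "L r = {x. infdist x Sg = r}" by (simp add: L_def dist_level_def Sg_def)
  have cont: "continuous_on UNIV g" using g DERIV_isCont continuous_at_imp_continuous_on by blast
  obtain y S where yS: "(y, S) \<in> U" "infdist (y, S) Sg = r" using U(2) by (auto simp: L)
  obtain \<epsilon> x0 where \<epsilon>: "\<epsilon> \<in> {-1, 1}" and x0: "foot (\<lambda>x. \<epsilon> * g x) r (y $ i) x0"
    and S: "S = g x0 + \<epsilon> * sqrt (r\<^sup>2 - (x0 - y $ i)\<^sup>2)"
    using infdist_graph_foot[OF yS(2)[unfolded Sg_def] r cont] .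
  define G where "G = (\<lambda>x. \<epsilon> * g x)"
  have G: "DERIV G x :> \<epsilon> * h x" for x unfolding G_def by (intro DERIV_cmult g)
  have GK: "\<bar>\<epsilon> * h x\<bar> \<le> K" for x using K[of x] \<epsilon> by (auto simp: abs_mult)
  have lip: "\<bar>G a - G b\<bar> \<le> K * \<bar>a - b\<bar>" for a b
    using field_differentiable_bound[of UNIV G "\<lambda>x. \<epsilon> * h x" K b a] G GK by (simp add: abs_minus_commute)
  have K0: "0 \<le> K" using K[of 0] by linarith
  obtain d where d: "d > 0" "ball (y, S) d \<subseteq> U" using U(1) yS(1) by (metis openE)
  \<comment> \<open>The height is \<open>K\<close>-Lipschitz in \<open>t\<close>, so a shift by at
    most \<open>e\<close> moves the point by at most \<open>(1 + K) * e = d / 2\<close> and keeps it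
    in \<open>U\<close>.\<close>
  define e where "e = d / (2 * (1 + K))"
  have e: "e > 0" using d K0 by (simp add: e_def)
  obtain t x1 x2 where t: "y $ i - e \<le> t" "t \<le> y $ i + e"
    and x: "foot G r t x1" "foot G r t x2" "x1 \<noteq> x2"
    using two_feet_dense[OF r _ G GK osc[OF \<epsilon>], of "y $ i - e" "y $ i + e"] e by auto
  define y' where "y' = y + (t - y $ i) *\<^sub>R axis i 1"
  have y't: "y' $ i = t" by (simp add: y'_def axis_def)
  define p where "p x = (y' + (x - t) *\<^sub>R axis i 1, g x)" for x
  define s where "s x = sqrt (r\<^sup>2 - (x - t)\<^sup>2)" for x
  define a where "a = (y', g x1 + \<epsilon> * s x1)"
  \<comment> \<open>For equal parameters the Lipschitz estimate, used both ways, shows that both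
    feet belong to the same point \<open>a\<close>.\<close>
  have "G x1 + s x1 = G x2 + s x2"
    using foot_height_le[OF x(1,2) lip] foot_height_le[OF x(2,1) lip] by (simp add: s_def)
  then have a2: "a = (y', g x2 + \<epsilon> * s x2)"
    using \<epsilon> by (auto simp: a_def G_def)
  have p1: "p x1 \<in> Sg" "dist a (p x1) = r" "infdist a Sg = r"
    using infdist_foot[of \<epsilon> g r y' i x1] x(1) \<epsilon> r
    by (simp_all add: y't G_def p_def a_def s_def Sg_def)
  have p2: "p x2 \<in> Sg" "dist a (p x2) = r"
    using infdist_foot[of \<epsilon> g r y' i x2] x(2) \<epsilon> r
    by (simp_all add: y't G_def p_def a2 s_def Sg_def)
  have "a \<in> U"
  proof -
    have te: "\<bar>t - y $ i\<bar> \<le> e" using t by linarith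
    have "\<bar>(G x1 + s x1) - (G x0 + sqrt (r\<^sup>2 - (x0 - y $ i)\<^sup>2))\<bar> \<le> K * \<bar>t - y $ i\<bar>"
      using foot_height_le[OF x(1) x0[folded G_def] lip] foot_height_le[OF x0[folded G_def] x(1) lip]
      by (simp add: s_def abs_minus_commute abs_le_iff)
    then have "\<bar>(g x1 + \<epsilon> * s x1) - S\<bar> \<le> K * \<bar>t - y $ i\<bar>"
      using \<epsilon> by (auto simp: G_def S)
    then have "dist y y' + dist S (snd a) \<le> \<bar>t - y $ i\<bar> + K * \<bar>t - y $ i\<bar>"
      by (simp add: y'_def a_def dist_add_axis dist_real_def abs_minus_commute)
    also have "\<dots> = (1 + K) * \<bar>t - y $ i\<bar>" by (simp add: algebra_simps)
    also have "\<dots> \<le> (1 + K) * e" using te K0 by (intro mult_left_mono) auto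
    also have "(1 + K) * e = d / 2" using K0 by (simp add: e_def field_simps)
    finally have "dist y y' + dist S (snd a) < d" using d(1) by simp
    moreover have "dist (y, S) a = sqrt ((dist y y')\<^sup>2 + (dist S (snd a))\<^sup>2)"
      unfolding a_def snd_conv dist_Pair_Pair ..
    moreover have "\<dots> \<le> dist y y' + dist S (snd a)"
      by (rule sqrt_sum_squares_le_sum) auto
    ultimately have "a \<in> ball (y, S) d" by simp
    then show ?thesis using d(2) by (rule rev_subsetD)
  qed
  then have aM: "a \<in> U \<inter> L r" using p1 by (simp add: L)
  \<comment> \<open>Every point of the level set has distance at least \<open>r\<close> from
    \<open>q\<close>, and \<open>a\<close> attains it.\<close>
  have near: "dist a q \<le> dist b q" if "q \<in> Sg" "dist a q = r" "b \<in> U \<inter> L r" for b q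
    using infdist_le[OF that(1), of b] that(2,3) unfolding L by simp
  have "a \<noteq> p x1" using p1 r by auto
  then obtain c where c: "a - p x2 = c *\<^sub>R (a - p x1)"
    using C1_hypersurface_normals_parallel[OF M aM _ near[OF p1(1,2)] near[OF p2]] by blast
  \<comment> \<open>Equal lengths give \<open>c\<close> up to sign; the vertical parts both have the
    strict sign \<open>\<epsilon>\<close>, which excludes \<open>c = -1\<close>.\<close>
  have "\<bar>c\<bar> * r = r" using arg_cong[OF c, of norm] p1 p2 by (simp add: dist_norm)
  then have c1: "\<bar>c\<bar> = 1" using r by simp
  have "snd (a - p x1) = \<epsilon> * s x1" by (simp add: a_def p_def)
  moreover have "snd (a - p x2) = \<epsilon> * s x2" by (simp add: a2 p_def)
  moreover have "snd (a - p x2) = c * snd (a - p x1)" unfolding c by simp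
  ultimately have sc: "s x2 = c * s x1" using \<epsilon> by auto
  have "s x1 > 0" unfolding s_def foot_center(2)[OF x(1) r G] using r by (simp add: add_pos_nonneg)
  moreover have "s x2 > 0" unfolding s_def foot_center(2)[OF x(2) r G] using r by (simp add: add_pos_nonneg)
  ultimately have "c > 0" unfolding sc by (simp add: zero_less_mult_iff)
  then have "c = 1" using c1 by simp
  then have "p x1 = p x2" using c by simp
  then have "fst (p x1) $ i = fst (p x2) $ i" by (rule arg_cong)
  then show False using x(3) by (simp add: p_def y't axis_def)
qed

theorem corollary2p7:
  "\<exists>f :: (real ^ 'm) \<Rightarrow> real.
     C1_on f UNIV \<and>
     C1_hypersurface (graph_of f) \<and>
     (\<forall>r>0. \<forall>U. open U \<and> U \<inter> dist_level (graph_of f) r \<noteq> {} \<longrightarrow>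
        \<not> C1_hypersurface (U \<inter> dist_level (graph_of f) r))"
proof (intro exI conjI allI impI)
  fix i :: 'm
  let ?f = "\<lambda>y :: real ^ 'm. weier_int (y $ i)"
  show C1: "C1_on ?f UNIV" by (rule C1_on_component[OF DERIV_weier_int continuous_weier])
  show "C1_hypersurface (graph_of ?f)" by (rule C1_hypersurface_graph[OF C1])
  show "\<not> C1_hypersurface (U \<inter> dist_level (graph_of ?f) r)"
    if "r > 0" "open U \<and> U \<inter> dist_level (graph_of ?f) r \<noteq> {}" for r U
    using that
    by (intro dist_level_not_C1_hypersurface[OF DERIV_weier_int abs_weier_le weier_oscillates]) auto
qed

end
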